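(* Let $\Gamma=(V,E)$ be a countable graph, let $G\le\mathrm{Aut}(\Gamma)$ be a countable amenable group acting almost freely and almost transitively on $\Gamma$, and let $\lambda:V\to\mathbb{R}_{>0}$ be $G$-invariant. Given a fundamental domain $U_0$ of $G\curvearrowright\Gamma$, we have $$\lim_n\frac{\log Z_\Gamma(F_nU_0,\lambda)}{|F_n|}=\inf_{F\in\mathcal{F}(G)}\frac{\log Z_\Gamma(FU_0,\lambda)}{|F|}$$ for any (right) F\o lner sequence $\{F_n\}_n$ of $G$.
   Context: A graph has a countable vertex set and symmetric edge relation; graphs are loopless. $X(\Gamma)\subseteq\{0,1\}^V$ is the set of (indicator functions of) independent sets. For finite $U\subseteq V$, $Z_\Gamma(U,\lambda)=\sum_x\prod_{v\in U}\lambda(v)^{x(v)}$, the sum over $x\in X(\Gamma)$ with $x(v)=0$ for all $v\notin U$. $G$ acts on the left by $gv=g(v)$; the action is almost free if every vertex stabilizer is finite, and almost transitive if there are finitely many orbits. $\lambda$ is $G$-invariant if $\lambda(gv)=\lambda(v)$. A fundamental domain is a set $U_0\subseteq V$ containing exactly one vertex of each $G$-orbit. $\mathcal{F}(G)$ is the set of finite nonempty subsets of $G$; $FU_0=\{gv:g\in F,v\in U_0\}$. A right F\o lner sequence is $\{F_n\}_n\subseteq\mathcal{F}(G)$ with $|F_ng\triangle F_n|/|F_n|\to0$ for all $g\in G$; $G$ is amenable if it has one. *)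

theory Defs
  imports
    "HOL-Analysis.Analysis"
    "HOL-Algebra.Group_Action"
    "Graph_Theory.Pair_Digraph"
begin

section \<open>Graphs and their automorphisms\<close>

text \<open>
  The locale \<open>pair_bidirected_digraph\<close> describes exactly a vertex set together with a symmetric,
  irreflexive edge relation on it; it imposes no finiteness.
\<close>

definition countable_graph :: "'v pair_pre_digraph \<Rightarrow> bool" where
  "countable_graph \<Gamma> \<longleftrightarrow> pair_bidirected_digraph \<Gamma> \<and> countable (pverts \<Gamma>)"

definition graph_automorphisms :: "'v pair_pre_digraph \<Rightarrow> ('v \<Rightarrow> 'v) set" where
  "graph_automorphisms \<Gamma> =
    {g \<in> Bij (pverts \<Gamma>).
      \<forall>u\<in>pverts \<Gamma>. \<forall>v\<in>pverts \<Gamma>. (g u, g v) \<in> parcs \<Gamma> \<longleftrightarrow> (u, v) \<in> parcs \<Gamma>}"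

definition Aut :: "'v pair_pre_digraph \<Rightarrow> ('v \<Rightarrow> 'v) monoid" where
  "Aut \<Gamma> = (BijGroup (pverts \<Gamma>))\<lparr>carrier := graph_automorphisms \<Gamma>\<rparr>"

text \<open>
  A set \<open>G\<close> of automorphisms regarded as a group. Its elements are themselves functions on vertices,
  so the action on \<open>pverts \<Gamma>\<close> is \<open>\<lambda>g. g\<close>.
\<close>

abbreviation Aut_sub :: "'v pair_pre_digraph \<Rightarrow> ('v \<Rightarrow> 'v) set \<Rightarrow> ('v \<Rightarrow> 'v) monoid" where
  "Aut_sub \<Gamma> G \<equiv> (Aut \<Gamma>)\<lparr>carrier := G\<rparr>"


section \<open>The partition function of the hardcore model\<close>

definition independent_sets :: "'v pair_pre_digraph \<Rightarrow> 'v set set" where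
  "independent_sets \<Gamma> = {I. I \<subseteq> pverts \<Gamma> \<and> (\<forall>u\<in>I. \<forall>v\<in>I. (u, v) \<notin> parcs \<Gamma>)}"

text \<open>
  Configurations are total functions on the vertex type; being indicators of subsets of
  \<open>pverts \<Gamma>\<close> they vanish off \<open>pverts \<Gamma>\<close>, so they correspond to elements of \<open>{0,1}\<^sup>V\<close>.
\<close>

definition configurations :: "'v pair_pre_digraph \<Rightarrow> ('v \<Rightarrow> nat) set" where
  "configurations \<Gamma> = indicator ` independent_sets \<Gamma>"

definition partition_function :: "'v pair_pre_digraph \<Rightarrow> 'v set \<Rightarrow> ('v \<Rightarrow> real) \<Rightarrow> real" where
  "partition_function \<Gamma> U lam =
    (\<Sum>x\<in>{x \<in> configurations \<Gamma>. \<forall>v\<in>pverts \<Gamma> - U. x v = 0}. \<Prod>v\<in>U. lam v ^ x v)"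


section \<open>Group actions\<close>

definition almost_free :: "('g, 'b) monoid_scheme \<Rightarrow> 'v set \<Rightarrow> ('g \<Rightarrow> 'v \<Rightarrow> 'v) \<Rightarrow> bool" where
  "almost_free G V \<phi> \<longleftrightarrow> (\<forall>v\<in>V. finite (stabilizer G \<phi> v))"

definition almost_transitive :: "('g, 'b) monoid_scheme \<Rightarrow> 'v set \<Rightarrow> ('g \<Rightarrow> 'v \<Rightarrow> 'v) \<Rightarrow> bool" where
  "almost_transitive G V \<phi> \<longleftrightarrow> finite (orbits G V \<phi>)"

definition fundamental_domain ::
    "('g, 'b) monoid_scheme \<Rightarrow> 'v set \<Rightarrow> ('g \<Rightarrow> 'v \<Rightarrow> 'v) \<Rightarrow> 'v set \<Rightarrow> bool" where
  "fundamental_domain G V \<phi> U\<^sub>0 \<longleftrightarrow> U\<^sub>0 \<subseteq> V \<and> (\<forall>Q\<in>orbits G V \<phi>. \<exists>!v. v \<in> U\<^sub>0 \<inter> Q)"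

definition invariant_function ::
    "('g, 'b) monoid_scheme \<Rightarrow> 'v set \<Rightarrow> ('g \<Rightarrow> 'v \<Rightarrow> 'v) \<Rightarrow> ('v \<Rightarrow> 'c) \<Rightarrow> bool" where
  "invariant_function G V \<phi> f \<longleftrightarrow> (\<forall>g\<in>carrier G. \<forall>v\<in>V. f (\<phi> g v) = f v)"

definition translates :: "('g \<Rightarrow> 'v \<Rightarrow> 'v) \<Rightarrow> 'g set \<Rightarrow> 'v set \<Rightarrow> 'v set" where
  "translates \<phi> F U = {\<phi> g v | g v. g \<in> F \<and> v \<in> U}"


section \<open>Amenability\<close>

definition finite_nonempty_subsets :: "('g, 'b) monoid_scheme \<Rightarrow> 'g set set" where
  "finite_nonempty_subsets G = {F. F \<subseteq> carrier G \<and> finite F \<and> F \<noteq> {}}"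

definition right_Folner :: "('g, 'b) monoid_scheme \<Rightarrow> (nat \<Rightarrow> 'g set) \<Rightarrow> bool" where
  "right_Folner G F \<longleftrightarrow>
    (\<forall>n. F n \<in> finite_nonempty_subsets G) \<and>
    (\<forall>g\<in>carrier G.
      (\<lambda>n. real (card (sym_diff (F n #>\<^bsub>G\<^esub> g) (F n))) / real (card (F n))) \<longlonglongrightarrow> 0)"

definition amenable :: "('g, 'b) monoid_scheme \<Rightarrow> bool" where
  "amenable G \<longleftrightarrow> (\<exists>F. right_Folner G F)"

end

theory Submission
  imports Defs
begin

text \<open>
  Write \<open>f K = ln Z(K U\<^sub>0)\<close> for finite nonempty \<open>K \<subseteq> G\<close>. Everything follows from the inequality
  \<open>|K| f L \<le> |L K\<^sup>-\<^sup>1| f K\<close>, valid for all finite nonempty \<open>K\<close> and \<open>L\<close>. Dividing it by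
  \<open>|K| |L|\<close> with \<open>L = F\<^sub>n\<close>, and using that \<open>|F\<^sub>n K\<^sup>-\<^sup>1| / |F\<^sub>n|\<close> is at most \<open>1 + o(1)\<close> along a right
  Folner sequence, bounds the limit superior of \<open>f F\<^sub>n / |F\<^sub>n|\<close> by \<open>f K / |K|\<close> for every \<open>K\<close>, hence by
  the infimum; and no term of the sequence lies below the infimum
  (\<open>Folner_infimum_rule\<close>).

  The inequality comes from covering \<open>L U\<^sub>0\<close> by the translates \<open>g K U\<^sub>0\<close> with \<open>g\<close> in \<open>L K\<^sup>-\<^sup>1\<close>: the
  point \<open>h u\<close> lies in the translate by \<open>h k\<^sup>-\<^sup>1\<close> for each \<open>k \<in> K\<close>, so every vertex is covered at least
  \<open>|K|\<close> times (\<open>translates_cover\<close>). Each translate has the same partition function as \<open>K U\<^sub>0\<close>, because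
  \<open>g\<close> is an automorphism preserving \<open>lam\<close>. What remains is a Shearer inequality for the hardcore model:
  if the sets \<open>A\<^sub>i\<close> cover \<open>W\<close> at least \<open>k\<close> times, then \<open>Z(W)\<^sup>k \<le> \<Prod>\<^sub>i Z(A\<^sub>i)\<close>
  (\<open>partition_function_Shearer\<close>). Strong subadditivity of \<open>ln Z\<close> would imply it but fails
  already for a path with three vertices, so it is derived instead from a weighted inequality
  for sums over subsets (\<open>weighted_Shearer\<close>), which is proved one vertex at a time; a single
  vertex amounts to the superadditivity of the geometric mean.
\<close>

section \<open>A Shearer inequality for weights on subsets\<close>

text \<open>
  For \<open>C = 1\<close> this is superadditivity of the geometric mean of \<open>k = card J\<close> numbers. Dividing
  \<open>a i\<close> and \<open>b i\<close> by \<open>a i + b i\<close> reduces it to two instances of the inequality between arithmetic and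
  geometric means, whose right-hand sides add up to 1. Stating it with powers instead of roots,
  and with the constant \<open>C\<close>, is the form in which a single summation step produces it.
\<close>

lemma geometric_mean_superadditive:
  fixes a b :: "'i \<Rightarrow> real" and x y C :: real
  assumes J: "finite J" "J \<noteq> {}"
    and a: "\<And>i. i \<in> J \<Longrightarrow> 0 \<le> a i" and b: "\<And>i. i \<in> J \<Longrightarrow> 0 \<le> b i"
    and nonneg: "0 \<le> C" "0 \<le> x" "0 \<le> y"
    and x: "x ^ card J \<le> C * (\<Prod>i\<in>J. a i)"
    and y: "y ^ card J \<le> C * (\<Prod>i\<in>J. b i)"
  shows "(x + y) ^ card J \<le> C * (\<Prod>i\<in>J. a i + b i)"
proof (cases "\<exists>i\<in>J. a i + b i = 0")
  case True
  then obtain i where "i \<in> J" "a i = 0" "b i = 0"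
    using a b by (metis add_nonneg_eq_0_iff)
  then have "(\<Prod>i\<in>J. a i) = 0" "(\<Prod>i\<in>J. b i) = 0"
    using J by (auto intro!: prod_zero)
  then have "x ^ card J = 0" "y ^ card J = 0"
    using x y zero_le_power[OF nonneg(2), of "card J"] zero_le_power[OF nonneg(3), of "card J"]
    by simp_all
  then have "(x + y) ^ card J = 0"
    using J by auto
  moreover have "0 \<le> C * (\<Prod>i\<in>J. a i + b i)"
    using a b nonneg by (intro mult_nonneg_nonneg prod_nonneg) auto
  ultimately show ?thesis by (rule ord_eq_le_trans)
next
  case False
  define k where "k = card J"
  have k: "0 < k" using J by (auto simp: k_def card_gt_0_iff)
  have pos: "0 < a i + b i" if "i \<in> J" for i
    using False that a[OF that] b[OF that] by (metis add_nonneg_nonneg order_le_less)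
  define D where "D = C * (\<Prod>i\<in>J. a i + b i)"
  have D: "0 \<le> D" unfolding D_def
    using pos nonneg by (intro mult_nonneg_nonneg prod_nonneg) (auto intro: less_imp_le)
  \<comment> \<open>The \<open>k\<close>-th root of the target bound; it suffices to show \<open>x + y \<le> c\<close>.\<close>
  define c where "c = D powr (1 / k)"
  have ck: "c ^ k = D"
    using D k by (cases "D = 0") (auto simp: c_def powr_power)
  have bound: "z \<le> c * (\<Sum>i\<in>J. d i / (a i + b i) / k)"
    if z: "0 \<le> z" "z ^ k \<le> C * (\<Prod>i\<in>J. d i)" and d: "\<And>i. i \<in> J \<Longrightarrow> 0 \<le> d i" for z d
  proof -
    have dp: "0 \<le> d i / (a i + b i)" if "i \<in> J" for i
      using d pos that by (simp add: less_imp_le)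
    have "C * (\<Prod>i\<in>J. d i) = D * (\<Prod>i\<in>J. d i / (a i + b i))"
      unfolding D_def using pos J
      by (simp add: prod_dividef prod_zero_iff) (metis less_irrefl)
    then have "z ^ k \<le> D * (\<Prod>i\<in>J. d i / (a i + b i))"
      using z by simp
    then have "(z ^ k) powr (1 / k) \<le> (D * (\<Prod>i\<in>J. d i / (a i + b i))) powr (1 / k)"
      using z by (intro powr_mono2) auto
    also have "(z ^ k) powr (1 / k) = z"
      using z k by (cases "z = 0") (auto simp: powr_powr simp flip: powr_realpow)
    also have "(D * (\<Prod>i\<in>J. d i / (a i + b i))) powr (1 / k)
        = c * (\<Prod>i\<in>J. d i / (a i + b i)) powr (1 / k)"
      unfolding c_def using D dp by (simp add: powr_mult prod_nonneg)
    also have "\<dots> \<le> c * (\<Sum>i\<in>J. d i / (a i + b i) / k)"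
      using arith_geom_mean[OF J dp] unfolding k_def[symmetric] c_def
      by (intro mult_left_mono) auto
    finally show ?thesis .
  qed
  have "x + y \<le> c * (\<Sum>i\<in>J. a i / (a i + b i) / k) + c * (\<Sum>i\<in>J. b i / (a i + b i) / k)"
    using bound[of x a] bound[of y b] x y a b nonneg by (auto simp: k_def)
  also have "\<dots> = c * (\<Sum>i\<in>J. 1 / k)"
  proof -
    have "a i / (a i + b i) / k + b i / (a i + b i) / k = 1 / k" if "i \<in> J" for i
      using pos[OF that] by (simp flip: add_divide_distrib)
    then show ?thesis by (simp flip: distrib_left sum.distrib)
  qed
  also have "\<dots> = c" using k by (simp add: k_def)
  finally have "(x + y) ^ k \<le> c ^ k"
    using nonneg by (intro power_mono) auto
  then show ?thesis
    using ck by (simp add: D_def k_def)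
qed

lemma sum_Pow_insert:
  fixes f :: "'a set \<Rightarrow> 'b::comm_monoid_add"
  assumes "finite A" "v \<notin> A"
  shows "(\<Sum>x\<in>Pow (insert v A). f x) = (\<Sum>x\<in>Pow A. f x + f (insert v x))"
proof -
  have "(\<Sum>x\<in>Pow (insert v A). f x) = (\<Sum>x\<in>Pow A. f x) + (\<Sum>x\<in>insert v ` Pow A. f x)"
    unfolding Pow_insert using assms by (intro sum.union_disjoint) auto
  also have "(\<Sum>x\<in>insert v ` Pow A. f x) = (\<Sum>x\<in>Pow A. f (insert v x))"
    using assms by (subst sum.reindex) (auto intro!: inj_onI simp: insert_ident subset_iff)
  finally show ?thesis by (simp add: sum.distrib)
qed

text \<open>
  A discrete form of Finner's inequality. Vertices are summed out one at a time: summing over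
  whether \<open>v\<close> belongs to \<open>x\<close> replaces \<open>w\<close> by \<open>w x + w (insert v x)\<close>, and likewise each of the
  \<open>k\<close> weights \<open>u i\<close> with \<open>v \<in> A i\<close>, while the remaining ones do not see \<open>v\<close> and act as a constant
  factor. The pointwise hypothesis survives this step by \<open>geometric_mean_superadditive\<close>; once all
  vertices are summed out, it is the conclusion.
\<close>

lemma weighted_Shearer:
  fixes w :: "'v set \<Rightarrow> real" and u :: "'i \<Rightarrow> 'v set \<Rightarrow> real" and A :: "'i \<Rightarrow> 'v set"
  assumes "finite V" "finite I" "0 < k"
    and "\<And>v. v \<in> V \<Longrightarrow> card {i \<in> I. v \<in> A i} = k"
    and "\<And>x. 0 \<le> w x" and "\<And>i y. 0 \<le> u i y"
    and "\<And>x. x \<subseteq> V \<Longrightarrow> w x ^ k \<le> (\<Prod>i\<in>I. u i (x \<inter> A i))"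
  shows "(\<Sum>x\<in>Pow V. w x) ^ k \<le> (\<Prod>i\<in>I. \<Sum>y\<in>Pow (A i \<inter> V). u i y)"
  using assms
proof (induction V arbitrary: w u rule: finite_induct)
  case empty
  then show ?case using empty.prems(6)[of "{}"] by simp
next
  case (insert v V)
  define w' where "w' = (\<lambda>x. w x + w (insert v x))"
  define u' where "u' = (\<lambda>i y. if v \<in> A i then u i y + u i (insert v y) else u i y)"
  define J where "J = {i \<in> I. v \<in> A i}"
  have J: "finite J" "J \<noteq> {}" "card J = k" "J \<subseteq> I"
    using insert.prems(1,2) insert.prems(3)[of v] by (auto simp: J_def card_gt_0_iff)
  have split: "prod f I = prod f (I - J) * prod f J" for f :: "'i \<Rightarrow> real"
    using J insert.prems(1) by (intro prod.subset_diff)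
  have "(\<Sum>x\<in>Pow V. w' x) ^ k \<le> (\<Prod>i\<in>I. \<Sum>y\<in>Pow (A i \<inter> V). u' i y)"
  proof (rule insert.IH)
    fix x assume x: "x \<subseteq> V"
    define C where "C = (\<Prod>i\<in>I - J. u i (x \<inter> A i))"
    have "w x ^ k \<le> C * (\<Prod>i\<in>J. u i (x \<inter> A i))"
      using insert.prems(6)[of x] x split[of "\<lambda>i. u i (x \<inter> A i)"] by (auto simp: C_def)
    moreover have "w (insert v x) ^ k \<le> C * (\<Prod>i\<in>J. u i (insert v (x \<inter> A i)))"
    proof -
      have "(\<Prod>i\<in>I - J. u i (insert v x \<inter> A i)) = C"
        unfolding C_def by (intro prod.cong) (auto simp: J_def)
      moreover have "(\<Prod>i\<in>J. u i (insert v x \<inter> A i)) = (\<Prod>i\<in>J. u i (insert v (x \<inter> A i)))"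
        by (intro prod.cong) (auto simp: J_def)
      ultimately show ?thesis
        using insert.prems(6)[of "insert v x"] x split[of "\<lambda>i. u i (insert v x \<inter> A i)"] by auto
    qed
    moreover have "0 \<le> C"
      unfolding C_def using insert.prems(5) by (intro prod_nonneg) auto
    ultimately have "(w x + w (insert v x)) ^ card J
        \<le> C * (\<Prod>i\<in>J. u i (x \<inter> A i) + u i (insert v (x \<inter> A i)))"
      using J insert.prems(4,5) by (intro geometric_mean_superadditive) auto
    moreover have "(\<Prod>i\<in>I - J. u' i (x \<inter> A i)) = C"
      unfolding C_def by (intro prod.cong) (auto simp: J_def u'_def)
    moreover have "(\<Prod>i\<in>J. u' i (x \<inter> A i)) = (\<Prod>i\<in>J. u i (x \<inter> A i) + u i (insert v (x \<inter> A i)))"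
      by (intro prod.cong) (auto simp: J_def u'_def)
    ultimately show "w' x ^ k \<le> (\<Prod>i\<in>I. u' i (x \<inter> A i))"
      using J split[of "\<lambda>i. u' i (x \<inter> A i)"] by (simp add: w'_def)
  qed (use insert.prems in \<open>auto simp: w'_def u'_def\<close>)
  moreover have "(\<Sum>x\<in>Pow V. w' x) = (\<Sum>x\<in>Pow (insert v V). w x)"
    using insert.hyps by (simp add: w'_def sum_Pow_insert)
  moreover have "(\<Sum>y\<in>Pow (A i \<inter> V). u' i y) = (\<Sum>y\<in>Pow (A i \<inter> insert v V). u i y)" for i
    using insert.hyps by (auto simp: u'_def sum_Pow_insert Int_insert_right)
  ultimately show ?case by simp
qed

section \<open>The partition function as a sum over independent sets\<close>

text \<open>
  Extending the weight by 0 to dependent sets turns the partition function into a sum over a full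
  power set, the shape that \<open>weighted_Shearer\<close> handles.
\<close>

definition hardcore_weight :: "'v pair_pre_digraph \<Rightarrow> ('v \<Rightarrow> real) \<Rightarrow> 'v set \<Rightarrow> real" where
  "hardcore_weight \<Gamma> lam x = (if x \<in> independent_sets \<Gamma> then \<Prod>v\<in>x. lam v else 0)"

lemma partition_function_eq_sum_weights:
  fixes \<Gamma> :: "'v pair_pre_digraph"
  assumes "finite U" "U \<subseteq> pverts \<Gamma>"
  shows "partition_function \<Gamma> U lam = (\<Sum>x\<in>Pow U. hardcore_weight \<Gamma> lam x)"
proof -
  have eq: "{x \<in> configurations \<Gamma>. \<forall>v\<in>pverts \<Gamma> - U. x v = 0}
      = (indicator :: 'v set \<Rightarrow> 'v \<Rightarrow> nat) ` (Pow U \<inter> independent_sets \<Gamma>)"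
    by (fastforce simp: configurations_def independent_sets_def indicator_eq_0_iff)
  have inj: "inj_on (indicator :: 'v set \<Rightarrow> 'v \<Rightarrow> nat) (Pow U \<inter> independent_sets \<Gamma>)"
    by (intro inj_onI) (metis indicator_eq_1_iff subsetI subset_antisym)
  have "(\<Prod>v\<in>U. lam v ^ indicator x v) = (\<Prod>v\<in>x. lam v)" if "x \<subseteq> U" for x
  proof -
    have "(\<Prod>v\<in>U. lam v ^ indicator x v) = (\<Prod>v\<in>U. if v \<in> x then lam v else 1)"
      by (intro prod.cong) (auto simp: indicator_def)
    also have "\<dots> = (\<Prod>v\<in>x. lam v)"
      using that assms(1) by (simp add: prod.If_cases Int_absorb1)
    finally show ?thesis .
  qed
  then have "partition_function \<Gamma> U lam = (\<Sum>x\<in>Pow U \<inter> independent_sets \<Gamma>. \<Prod>v\<in>x. lam v)"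
    unfolding partition_function_def eq sum.reindex[OF inj] by (intro sum.cong) auto
  also have "\<dots> = (\<Sum>x\<in>Pow U. hardcore_weight \<Gamma> lam x)"
    using assms(1) by (simp add: hardcore_weight_def sum.If_cases Int_def)
  finally show ?thesis .
qed

lemma hardcore_weight_nonneg:
  assumes "\<And>v. v \<in> pverts \<Gamma> \<Longrightarrow> 0 < lam v"
  shows "0 \<le> hardcore_weight \<Gamma> lam x"
proof -
  have "0 \<le> (\<Prod>v\<in>x. lam v)" if "x \<subseteq> pverts \<Gamma>"
    using assms that by (intro prod_nonneg) (auto intro: less_imp_le)
  then show ?thesis by (simp add: hardcore_weight_def independent_sets_def)
qed

lemma partition_function_mono:
  assumes "finite U" "U \<subseteq> pverts \<Gamma>" "W \<subseteq> U"
    and "\<And>v. v \<in> pverts \<Gamma> \<Longrightarrow> 0 < lam v"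
  shows "partition_function \<Gamma> W lam \<le> partition_function \<Gamma> U lam"
proof -
  have "finite W" "W \<subseteq> pverts \<Gamma>" using assms finite_subset by auto
  then show ?thesis
    using assms hardcore_weight_nonneg[of \<Gamma> lam]
    by (simp add: partition_function_eq_sum_weights) (intro sum_mono2; auto)
qed

lemma partition_function_empty: "partition_function \<Gamma> {} lam = 1"
  by (subst partition_function_eq_sum_weights) (auto simp: hardcore_weight_def independent_sets_def)

lemma partition_function_ge_1:
  assumes "finite U" "U \<subseteq> pverts \<Gamma>" "\<And>v. v \<in> pverts \<Gamma> \<Longrightarrow> 0 < lam v"
  shows "1 \<le> partition_function \<Gamma> U lam"
  using partition_function_mono[OF assms(1,2) empty_subsetI assms(3)]
  by (simp add: partition_function_empty)

text \<open>
  Every subset of an independent set is independent, so the right-hand side is positive whenever the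
  left-hand side is, and then each vertex of \<open>x\<close> contributes \<open>lam v ^ k\<close> to both sides.
\<close>

lemma hardcore_weight_submultiplicative:
  assumes pos: "\<And>v. v \<in> pverts \<Gamma> \<Longrightarrow> 0 < lam v"
    and x: "finite x" and I: "finite I"
    and cover: "\<And>v. v \<in> x \<Longrightarrow> card {i \<in> I. v \<in> A i} = k"
    and k: "0 < k"
  shows "hardcore_weight \<Gamma> lam x ^ k \<le> (\<Prod>i\<in>I. hardcore_weight \<Gamma> lam (x \<inter> A i))"
proof (cases "x \<in> independent_sets \<Gamma>")
  case True
  have "(\<Prod>i\<in>I. hardcore_weight \<Gamma> lam (x \<inter> A i)) = (\<Prod>i\<in>I. \<Prod>v\<in>x \<inter> A i. lam v)"
    using True by (intro prod.cong) (auto simp: hardcore_weight_def independent_sets_def)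
  also have "\<dots> = (\<Prod>i\<in>I. \<Prod>v\<in>x. if v \<in> A i then lam v else 1)"
    using x by (simp add: prod.inter_restrict)
  also have "\<dots> = (\<Prod>v\<in>x. \<Prod>i\<in>I. if v \<in> A i then lam v else 1)"
    by (rule prod.swap)
  also have "\<dots> = (\<Prod>v\<in>x. lam v ^ card {i \<in> I. v \<in> A i})"
    using I by (simp add: prod.If_cases Int_def)
  also have "\<dots> = (\<Prod>v\<in>x. lam v ^ k)"
    using cover by simp
  also have "\<dots> = hardcore_weight \<Gamma> lam x ^ k"
    using True by (simp add: hardcore_weight_def prod_power_distrib)
  finally show ?thesis by simp
next
  case False
  then have "hardcore_weight \<Gamma> lam x ^ k = 0"
    using k by (simp add: hardcore_weight_def)
  also have "0 \<le> (\<Prod>i\<in>I. hardcore_weight \<Gamma> lam (x \<inter> A i))"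
    by (intro prod_nonneg hardcore_weight_nonneg pos)
  finally show ?thesis .
qed

text \<open>
  A cover of multiplicity at least \<open>k\<close> is thinned out to one of multiplicity exactly \<open>k\<close>, which
  only decreases the right-hand side because the partition function is monotone.
\<close>

lemma partition_function_Shearer:
  fixes A :: "'i \<Rightarrow> 'v set"
  assumes W: "finite W" "W \<subseteq> pverts \<Gamma>" and I: "finite I"
    and A: "\<And>i. i \<in> I \<Longrightarrow> finite (A i) \<and> A i \<subseteq> pverts \<Gamma>"
    and k: "0 < k" and cover: "\<And>v. v \<in> W \<Longrightarrow> k \<le> card {i \<in> I. v \<in> A i}"
    and pos: "\<And>v. v \<in> pverts \<Gamma> \<Longrightarrow> 0 < lam v"
  shows "partition_function \<Gamma> W lam ^ k \<le> (\<Prod>i\<in>I. partition_function \<Gamma> (A i) lam)"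
proof -
  have "\<exists>S. S \<subseteq> {i \<in> I. v \<in> A i} \<and> card S = k" if "v \<in> W" for v
    using obtain_subset_with_card_n[OF cover[OF that]] by metis
  then obtain S where S: "\<And>v. v \<in> W \<Longrightarrow> S v \<subseteq> {i \<in> I. v \<in> A i}" "\<And>v. v \<in> W \<Longrightarrow> card (S v) = k"
    by metis
  \<comment> \<open>Each vertex \<open>v\<close> stays only in the \<open>k\<close> chosen sets with index in \<open>S v\<close>.\<close>
  define B where "B = (\<lambda>i. {v \<in> W. i \<in> S v})"
  have exact: "card {i \<in> I. v \<in> B i} = k" if "v \<in> W" for v
  proof -
    have "{i \<in> I. v \<in> B i} = S v" using S(1)[OF that] that by (auto simp: B_def)
    then show ?thesis using S(2)[OF that] by simp
  qed
  have BW: "B i \<inter> W = B i" for i by (auto simp: B_def)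
  have B: "B i \<subseteq> A i" for i using S(1) by (auto simp: B_def)
  have "(\<Sum>x\<in>Pow W. hardcore_weight \<Gamma> lam x) ^ k
      \<le> (\<Prod>i\<in>I. \<Sum>y\<in>Pow (B i \<inter> W). hardcore_weight \<Gamma> lam y)"
    using W I k exact hardcore_weight_nonneg[OF pos]
    by (intro weighted_Shearer hardcore_weight_submultiplicative pos)
       (auto intro: finite_subset)
  then have "partition_function \<Gamma> W lam ^ k
      \<le> (\<Prod>i\<in>I. \<Sum>y\<in>Pow (B i). hardcore_weight \<Gamma> lam y)"
    using W by (simp add: partition_function_eq_sum_weights BW)
  also have "\<dots> = (\<Prod>i\<in>I. partition_function \<Gamma> (B i) lam)"
    using W by (intro prod.cong partition_function_eq_sum_weights[symmetric])
      (auto simp: B_def)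
  also have "\<dots> \<le> (\<Prod>i\<in>I. partition_function \<Gamma> (A i) lam)"
  proof (intro prod_mono conjI)
    fix i assume i: "i \<in> I"
    have "1 \<le> partition_function \<Gamma> (B i) lam"
      using W by (intro partition_function_ge_1 pos) (auto simp: B_def)
    then show "0 \<le> partition_function \<Gamma> (B i) lam" by simp
    show "partition_function \<Gamma> (B i) lam \<le> partition_function \<Gamma> (A i) lam"
      using A[OF i] B by (intro partition_function_mono pos) auto
  qed
  finally show ?thesis .
qed

lemma partition_function_automorphism_image:
  assumes g: "g \<in> graph_automorphisms \<Gamma>" and U: "finite U" "U \<subseteq> pverts \<Gamma>"
    and lam: "\<And>v. v \<in> pverts \<Gamma> \<Longrightarrow> lam (g v) = lam v"
  shows "partition_function \<Gamma> (g ` U) lam = partition_function \<Gamma> U lam"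
proof -
  have inj: "inj_on g (pverts \<Gamma>)" and im: "g ` pverts \<Gamma> = pverts \<Gamma>"
    using g by (auto simp: graph_automorphisms_def Bij_def bij_betw_def)
  have injU: "inj_on g x" if "x \<subseteq> U" for x
    using inj U that by (meson inj_on_subset order_trans)
  have weight: "hardcore_weight \<Gamma> lam (g ` x) = hardcore_weight \<Gamma> lam x" if x: "x \<subseteq> U" for x
  proof -
    have "g ` x \<in> independent_sets \<Gamma> \<longleftrightarrow> x \<in> independent_sets \<Gamma>"
      using g x U im by (auto simp: independent_sets_def graph_automorphisms_def subset_iff)
    moreover have "(\<Prod>v\<in>g ` x. lam v) = (\<Prod>v\<in>x. lam v)"
      using x U lam by (subst prod.reindex[OF injU[OF x]]) (auto intro!: prod.cong)
    ultimately show ?thesis by (simp add: hardcore_weight_def)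
  qed
  have "Pow (g ` U) = (`) g ` Pow U" by (rule image_Pow_surj[symmetric]) simp
  moreover have "inj_on ((`) g) (Pow U)"
    using injU[of U] by (intro inj_on_image_Pow) auto
  ultimately have "(\<Sum>x\<in>Pow (g ` U). hardcore_weight \<Gamma> lam x)
      = (\<Sum>x\<in>Pow U. hardcore_weight \<Gamma> lam (g ` x))"
    by (simp add: sum.reindex)
  also have "\<dots> = (\<Sum>x\<in>Pow U. hardcore_weight \<Gamma> lam x)"
    using weight by (intro sum.cong) auto
  moreover have "g ` U \<subseteq> pverts \<Gamma>" using U im by auto
  ultimately show ?thesis using U by (simp add: partition_function_eq_sum_weights)
qed

section \<open>The infimum rule along right Folner sequences\<close>

lemma (in group) card_Folner_translate_le:
  assumes F: "finite F" "F \<subseteq> carrier G" and S: "finite S" "S \<subseteq> carrier G"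
  shows "card (F <#> S) \<le> card F + (\<Sum>s\<in>S. card (sym_diff (F #> s) F))"
proof -
  have fin: "finite (F #> s)" for s using F by (auto simp: r_coset_def)
  have "F <#> S \<subseteq> F \<union> (\<Union>s\<in>S. sym_diff (F #> s) F)"
    by (auto simp: set_mult_def r_coset_def)
  then have "card (F <#> S) \<le> card (F \<union> (\<Union>s\<in>S. sym_diff (F #> s) F))"
    using F S fin by (intro card_mono) auto
  also have "\<dots> \<le> card F + card (\<Union>s\<in>S. sym_diff (F #> s) F)"
    by (rule card_Un_le)
  also have "\<dots> \<le> card F + (\<Sum>s\<in>S. card (sym_diff (F #> s) F))"
    using card_UN_le[OF S(1)] by auto
  finally show ?thesis .
qed

text \<open>
  A version of the Ornstein--Weiss lemma in which the limit is even the infimum, because the covering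
  hypothesis compares \<open>L\<close> with \<open>K\<close> up to the factor \<open>|L K\<^sup>-\<^sup>1| / |L|\<close>. For \<open>L = F\<^sub>n\<close> this factor
  tends to 1: the elements of \<open>F\<^sub>n K\<^sup>-\<^sup>1\<close> outside \<open>F\<^sub>n\<close> lie in the finitely many symmetric
  differences of \<open>F\<^sub>n\<close> with its right translates by elements of \<open>K\<^sup>-\<^sup>1\<close>, and each of these has size
  \<open>o(|F\<^sub>n|)\<close>.
\<close>

lemma (in group) Folner_infimum_rule:
  fixes f :: "'a set \<Rightarrow> real"
  assumes F: "right_Folner G F"
    and nonneg: "\<And>K. K \<in> finite_nonempty_subsets G \<Longrightarrow> 0 \<le> f K"
    and covering: "\<And>K L. \<lbrakk>K \<in> finite_nonempty_subsets G; L \<in> finite_nonempty_subsets G\<rbrakk> \<Longrightarrow>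
      real (card K) * f L \<le> real (card (L <#> m_inv G ` K)) * f K"
  shows "(\<lambda>n. f (F n) / real (card (F n)))
    \<longlonglongrightarrow> (INF K\<in>finite_nonempty_subsets G. f K / real (card K))"
proof (rule order_tendstoI)
  let ?fin = "finite_nonempty_subsets G"
  let ?c = "INF K\<in>?fin. f K / real (card K)"
  have Fn: "F n \<in> ?fin" for n using F by (auto simp: right_Folner_def)
  have bdd: "bdd_below ((\<lambda>K. f K / real (card K)) ` ?fin)"
    using nonneg by (intro bdd_belowI[of _ 0]) auto
  {
    fix y assume "y < ?c"
    moreover have "?c \<le> f (F n) / real (card (F n))" for n
      using bdd Fn by (rule cINF_lower)
    ultimately show "\<forall>\<^sub>F n in sequentially. y < f (F n) / real (card (F n))"
      by (intro always_eventually allI) (rule less_le_trans)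
  next
    fix y assume "?c < y"
    then obtain K where K: "K \<in> ?fin" and y: "f K / real (card K) < y"
      using Fn bdd by (subst (asm) cINF_less_iff) auto
    define S where "S = m_inv G ` K"
    \<comment> \<open>An upper bound for \<open>|F\<^sub>n S| / |F\<^sub>n|\<close> that tends to 1.\<close>
    define r where "r = (\<lambda>n. 1 + (\<Sum>s\<in>S. real (card (sym_diff (F n #> s) (F n))) / real (card (F n))))"
    have S: "finite S" "S \<subseteq> carrier G"
      using K by (auto simp: S_def finite_nonempty_subsets_def)
    have "r \<longlonglongrightarrow> 1 + (\<Sum>s\<in>S. 0)"
      unfolding r_def using F S
      by (intro tendsto_add tendsto_const tendsto_sum) (auto simp: right_Folner_def)
    then have "(\<lambda>n. r n * (f K / real (card K))) \<longlonglongrightarrow> 1 * (f K / real (card K))"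
      by (intro tendsto_mult tendsto_const) simp
    then have "\<forall>\<^sub>F n in sequentially. r n * (f K / real (card K)) < y"
      using y by (intro order_tendstoD) auto
    moreover have "f (F n) / real (card (F n)) \<le> r n * (f K / real (card K))" for n
    proof -
      have cards: "0 < real (card K)" "0 < real (card (F n))"
        using K Fn[of n] by (auto simp: finite_nonempty_subsets_def card_gt_0_iff)
      have "real (card (F n <#> S))
          \<le> real (card (F n) + (\<Sum>s\<in>S. card (sym_diff (F n #> s) (F n))))"
        using Fn[of n] S
        by (intro of_nat_mono card_Folner_translate_le) (auto simp: finite_nonempty_subsets_def)
      also have "\<dots> = r n * real (card (F n))"
        using cards by (simp add: r_def distrib_right sum_distrib_right)
      finally have "real (card K) * f (F n) \<le> r n * real (card (F n)) * f K"
        using covering[OF K Fn[of n]] nonneg[OF K] unfolding S_def[symmetric]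
        by (meson mult_right_mono order_trans)
      then show ?thesis using cards by (simp add: field_simps)
    qed
    ultimately show "\<forall>\<^sub>F n in sequentially. f (F n) / real (card (F n)) < y"
      by (blast intro: eventually_mono le_less_trans)
  }
qed

section \<open>Translates of a fundamental domain\<close>

lemma (in group_action) finite_fundamental_domain:
  assumes "almost_transitive G E \<phi>" "fundamental_domain G E \<phi> U"
  shows "finite U"
proof -
  have U: "U \<subseteq> E" and uniq: "\<And>Q. Q \<in> orbits G E \<phi> \<Longrightarrow> \<exists>!v. v \<in> U \<inter> Q"
    using assms(2) by (auto simp: fundamental_domain_def)
  have mem: "v \<in> orbit G \<phi> v" if "v \<in> U" for v
    using that U by (intro orbit_refl) auto
  have orb: "orbit G \<phi> v \<in> orbits G E \<phi>" if "v \<in> U" for v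
    using that U by (auto simp: orbits_def)
  have "inj_on (orbit G \<phi>) U"
    by (rule inj_onI) (metis IntI mem orb uniq)
  moreover have "finite (orbit G \<phi> ` U)"
    using assms(1) orb by (auto simp: almost_transitive_def intro: finite_subset)
  ultimately show ?thesis using finite_imageD by blast
qed

text \<open>
  If \<open>v = h u\<close> with \<open>h \<in> L\<close>, then \<open>v = (h k\<^sup>-\<^sup>1) (k u)\<close> for each \<open>k \<in> K\<close>, and the elements
  \<open>h k\<^sup>-\<^sup>1\<close> are distinct. Nontrivial stabilizers can only add further translates containing \<open>v\<close>,
  which is why the multiplicity is bounded from below only.
\<close>

lemma (in group_action) translates_cover:
  assumes K: "finite K" "K \<subseteq> carrier G" and L: "finite L" "L \<subseteq> carrier G" and U: "U \<subseteq> E"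
    and v: "v \<in> translates \<phi> L U"
  shows "card K \<le> card {g \<in> L <#> m_inv G ` K. v \<in> \<phi> g ` translates \<phi> K U}"
proof -
  interpret group G using group_hom group_hom.axioms(1) by auto
  obtain h u where h: "h \<in> L" "u \<in> U" "v = \<phi> h u"
    using v by (auto simp: translates_def)
  have hc: "h \<in> carrier G" and uE: "u \<in> E" using h L U by auto
  have "inj_on (\<lambda>k. h \<otimes> inv k) K"
    using K hc by (intro inj_onI) (metis Units_eq Units_l_cancel inv_closed inv_inv subsetD)
  then have "card K = card ((\<lambda>k. h \<otimes> inv k) ` K)" by (simp add: card_image)
  also have "\<dots> \<le> card {g \<in> L <#> m_inv G ` K. v \<in> \<phi> g ` translates \<phi> K U}"
  proof (rule card_mono)
    have "L <#> m_inv G ` K = (\<lambda>(h, k). h \<otimes> inv k) ` (L \<times> K)"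
      by (auto simp: set_mult_def)
    then show "finite {g \<in> L <#> m_inv G ` K. v \<in> \<phi> g ` translates \<phi> K U}"
      using K L by simp
    show "(\<lambda>k. h \<otimes> inv k) ` K \<subseteq> {g \<in> L <#> m_inv G ` K. v \<in> \<phi> g ` translates \<phi> K U}"
    proof (rule image_subsetI)
      fix k assume k: "k \<in> K"
      then have kc: "k \<in> carrier G" using K by auto
      have "\<phi> (h \<otimes> inv k) (\<phi> k u) = \<phi> (h \<otimes> inv k \<otimes> k) u"
        using kc hc uE by (simp add: composition_rule)
      also have "\<dots> = v"
        using kc hc h by (simp add: m_assoc)
      finally have "v \<in> \<phi> (h \<otimes> inv k) ` translates \<phi> K U"
        using k h by (force simp: translates_def)
      then show "h \<otimes> inv k \<in> {g \<in> L <#> m_inv G ` K. v \<in> \<phi> g ` translates \<phi> K U}"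
        using k h by (auto simp: set_mult_def)
    qed
  qed
  finally show ?thesis .
qed

section \<open>The action of a group of automorphisms\<close>

lemma subgroup_graph_automorphisms: "subgroup (graph_automorphisms \<Gamma>) (BijGroup (pverts \<Gamma>))"
proof -
  let ?V = "pverts \<Gamma>"
  interpret B: group "BijGroup ?V" by (rule group_BijGroup)
  show ?thesis
  proof (rule B.subgroupI)
    show "graph_automorphisms \<Gamma> \<subseteq> carrier (BijGroup ?V)"
      by (auto simp: graph_automorphisms_def BijGroup_def)
    have "(\<lambda>x\<in>?V. x) \<in> graph_automorphisms \<Gamma>"
      by (auto simp: graph_automorphisms_def id_Bij)
    then show "graph_automorphisms \<Gamma> \<noteq> {}" by auto
  next
    fix g assume g: "g \<in> graph_automorphisms \<Gamma>"
    then have gB: "g \<in> Bij ?V" by (simp add: graph_automorphisms_def)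
    then have bij: "bij_betw g ?V ?V" by (simp add: Bij_def)
    have "(inv_into ?V g u, inv_into ?V g v) \<in> parcs \<Gamma> \<longleftrightarrow> (u, v) \<in> parcs \<Gamma>"
      if "u \<in> ?V" "v \<in> ?V" for u v
    proof -
      have "inv_into ?V g u \<in> ?V" "inv_into ?V g v \<in> ?V"
        "g (inv_into ?V g u) = u" "g (inv_into ?V g v) = v"
        using bij that by (auto simp: bij_betw_def f_inv_into_f inv_into_into)
      then show ?thesis
        using g by (fastforce simp: graph_automorphisms_def)
    qed
    then show "inv\<^bsub>BijGroup ?V\<^esub> g \<in> graph_automorphisms \<Gamma>"
      using restrict_inv_into_Bij[OF gB] by (simp add: inv_BijGroup[OF gB] graph_automorphisms_def)
  next
    fix g h assume gh: "g \<in> graph_automorphisms \<Gamma>" "h \<in> graph_automorphisms \<Gamma>"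
    then have "g \<in> Bij ?V" "h \<in> Bij ?V" "\<And>v. v \<in> ?V \<Longrightarrow> h v \<in> ?V"
      using Bij_imp_funcset by (auto simp: graph_automorphisms_def)
    then show "g \<otimes>\<^bsub>BijGroup ?V\<^esub> h \<in> graph_automorphisms \<Gamma>"
      using gh by (auto simp: graph_automorphisms_def BijGroup_def compose_Bij compose_eq)
  qed
qed

lemma group_action_Aut_sub:
  assumes "subgroup G (Aut \<Gamma>)"
  shows "group_action (Aut_sub \<Gamma> G) (pverts \<Gamma>) (\<lambda>g. g)"
proof -
  have "group (Aut \<Gamma>)"
    unfolding Aut_def
    by (rule subgroup.subgroup_is_group[OF subgroup_graph_automorphisms group_BijGroup])
  with assms have grp: "group (Aut_sub \<Gamma> G)" by (rule subgroup.subgroup_is_group)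
  have carrier: "carrier (BijGroup (pverts \<Gamma>)) = Bij (pverts \<Gamma>)"
    by (simp add: BijGroup_def)
  have "G \<subseteq> Bij (pverts \<Gamma>)"
    using subgroup.subset[OF assms] by (auto simp: Aut_def graph_automorphisms_def)
  then have "(\<lambda>g. g) \<in> hom (Aut_sub \<Gamma> G) (BijGroup (pverts \<Gamma>))"
    by (auto simp: hom_def Aut_def carrier)
  with grp show ?thesis
    by (simp add: group_action_def group_hom_def group_hom_axioms_def group_BijGroup)
qed

section \<open>Convergence of the normalized log-partition functions\<close>

theorem proposition3p4:
  fixes \<Gamma> :: "'v pair_pre_digraph"
    and G :: "('v \<Rightarrow> 'v) set"
    and lam :: "'v \<Rightarrow> real"
    and U\<^sub>0 :: "'v set"
    and F :: "nat \<Rightarrow> ('v \<Rightarrow> 'v) set"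
  assumes "countable_graph \<Gamma>"
    and "subgroup G (Aut \<Gamma>)"
    and "countable G"
    and "amenable (Aut_sub \<Gamma> G)"
    and "almost_free (Aut_sub \<Gamma> G) (pverts \<Gamma>) (\<lambda>g. g)"
    and "almost_transitive (Aut_sub \<Gamma> G) (pverts \<Gamma>) (\<lambda>g. g)"
    and "\<And>v. v \<in> pverts \<Gamma> \<Longrightarrow> lam v > 0"
    and "invariant_function (Aut_sub \<Gamma> G) (pverts \<Gamma>) (\<lambda>g. g) lam"
    and "fundamental_domain (Aut_sub \<Gamma> G) (pverts \<Gamma>) (\<lambda>g. g) U\<^sub>0"
    and "right_Folner (Aut_sub \<Gamma> G) F"
  shows "(\<lambda>n. ln (partition_function \<Gamma> (translates (\<lambda>g. g) (F n) U\<^sub>0) lam) / real (card (F n)))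
    \<longlonglongrightarrow> (INF K\<in>finite_nonempty_subsets (Aut_sub \<Gamma> G).
           ln (partition_function \<Gamma> (translates (\<lambda>g. g) K U\<^sub>0) lam) / real (card K))"
proof -
  let ?H = "Aut_sub \<Gamma> G"
  let ?T = "\<lambda>K. translates (\<lambda>g. g) K U\<^sub>0"
  let ?Z = "\<lambda>U. partition_function \<Gamma> U lam"
  interpret act: group_action ?H "pverts \<Gamma>" "\<lambda>g. g"
    using assms(2) by (rule group_action_Aut_sub)
  interpret H: group ?H
    using act.group_hom group_hom.axioms(1) by auto
  have U0: "U\<^sub>0 \<subseteq> pverts \<Gamma>" "finite U\<^sub>0"
    using assms(9) act.finite_fundamental_domain[OF assms(6,9)]
    by (auto simp: fundamental_domain_def)
  have GA: "G \<subseteq> graph_automorphisms \<Gamma>"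
    using subgroup.subset[OF assms(2)] by (simp add: Aut_def)
  have T: "finite (?T K)" "?T K \<subseteq> pverts \<Gamma>" if "K \<in> finite_nonempty_subsets ?H" for K
  proof -
    have K: "finite K" "K \<subseteq> G" using that by (auto simp: finite_nonempty_subsets_def)
    have "?T K = (\<lambda>(g, v). g v) ` (K \<times> U\<^sub>0)" by (auto simp: translates_def)
    then show "finite (?T K)" using K U0 by simp
    show "?T K \<subseteq> pverts \<Gamma>"
      using K U0 act.element_image by (fastforce simp: translates_def)
  qed
  have Z1: "1 \<le> ?Z (?T K)" if "K \<in> finite_nonempty_subsets ?H" for K
    using T[OF that] assms(7) by (intro partition_function_ge_1)
  show ?thesis
  proof (rule H.Folner_infimum_rule[OF assms(10)])
    fix K assume "K \<in> finite_nonempty_subsets ?H"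
    then show "0 \<le> ln (?Z (?T K))" using Z1 by simp
  next
    fix K L assume K: "K \<in> finite_nonempty_subsets ?H" and L: "L \<in> finite_nonempty_subsets ?H"
    let ?I = "L <#>\<^bsub>?H\<^esub> m_inv ?H ` K"
    have KL: "finite K" "K \<subseteq> carrier ?H" "0 < card K" "finite L" "L \<subseteq> carrier ?H"
      using K L by (auto simp: finite_nonempty_subsets_def card_gt_0_iff)
    have "?I = (\<lambda>(h, k). h \<otimes>\<^bsub>?H\<^esub> inv\<^bsub>?H\<^esub> k) ` (L \<times> K)"
      by (auto simp: set_mult_def)
    then have fin: "finite ?I" using KL by simp
    have IG: "?I \<subseteq> carrier ?H"
      using KL H.inv_closed by (intro H.set_mult_closed) auto
    have "?Z (?T L) ^ card K \<le> (\<Prod>g\<in>?I. ?Z (g ` ?T K))"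
    proof (rule partition_function_Shearer)
      fix g assume "g \<in> ?I"
      then have "g ` pverts \<Gamma> = pverts \<Gamma>" using IG act.surj_prop by auto
      then show "finite (g ` ?T K) \<and> g ` ?T K \<subseteq> pverts \<Gamma>" using T[OF K] by auto
    next
      fix v assume "v \<in> ?T L"
      then show "card K \<le> card {g \<in> ?I. v \<in> g ` ?T K}"
        using KL U0 by (intro act.translates_cover)
    qed (use T[OF L] fin KL assms(7) in auto)
    also have "\<dots> = (\<Prod>g\<in>?I. ?Z (?T K))"
    proof (intro prod.cong refl partition_function_automorphism_image)
      fix g assume g: "g \<in> ?I"
      then show "g \<in> graph_automorphisms \<Gamma>" using IG GA by auto
      show "lam (g v) = lam v" if "v \<in> pverts \<Gamma>" for v
        using assms(8) IG g that by (auto simp: invariant_function_def)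
    qed (use T[OF K] in auto)
    also have "\<dots> = ?Z (?T K) ^ card ?I" by simp
    finally have le: "?Z (?T L) ^ card K \<le> ?Z (?T K) ^ card ?I" .
    have "0 < ?Z (?T L) ^ card K" using Z1[OF L] by (intro zero_less_power) linarith
    with le have "ln (?Z (?T L) ^ card K) \<le> ln (?Z (?T K) ^ card ?I)"
      by (intro ln_mono) auto
    then show "real (card K) * ln (?Z (?T L)) \<le> real (card ?I) * ln (?Z (?T K))"
      using Z1[OF K] Z1[OF L] by (simp add: ln_realpow)
  qed
qed

end
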